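(* Let $G=(V,E)$ be a connected $d$-regular graph on $n$ nodes, and let $(\xi(t))_{t\ge0}$ be the Node Model on $G$ with parameters $\alpha\in(0,1)$ and integer $k\ge1$. Write $\mathrm{Avg}(t)=\frac1n\sum_{u\in V}\xi_u(t)$ and assume (without loss of generality) $\mathrm{Avg}(0)=0$. Let $E^+=\{(u,v)\mid\{u,v\}\in E\}$ be the set of directed edges. Put $$\gamma=k(1+\alpha)-(1-\alpha),\qquad \ell=\frac{1}{n\left(n(d\gamma-2\alpha k)+2(1-\alpha)(d-k)\right)},$$ $$\mu_0=2k(d-1)\ell,\qquad \mu_1=(d-1)\gamma\ell,\qquad \mu_+=(d\gamma-2\alpha k)\ell.$$ Then, for any $t\ge0$, $$\mathrm{Var}(\mathrm{Avg}(t))\le(\mu_0-\mu_+)\sum_{u\in V}\xi_u^2(0)+(\mu_1-\mu_+)\sum_{(u,v)\in E^+}\xi_u(0)\xi_v(0)+\frac1{n^5}.$$ Furthermore, there exists $T$ large enough such that for all $t\ge T$, $$\mathrm{Var}(\mathrm{Avg}(t))\ge(\mu_0-\mu_+)\sum_{u\in V}\xi_u^2(0)+(\mu_1-\mu_+)\sum_{(u,v)\in E^+}\xi_u(0)\xi_v(0)-\frac1{n^5}.$$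
   Context: Node Model with parameters $\alpha$ and integer $k\ge1$: $\xi(0)\in\mathbb{R}^n$ is a given deterministic vector. At each step $t\ge1$ a node $u$ is chosen uniformly at random, and then $k$ of its neighbours $v_1,\dots,v_k$ are chosen uniformly at random without replacement (so $k\le d$); then $\xi_u(t)=\alpha\,\xi_u(t-1)+\frac{1-\alpha}{k}\sum_{i=1}^k\xi_{v_i}(t-1)$ and $\xi_v(t)=\xi_v(t-1)$ for all $v\ne u$. *)

theory Defs
  imports "HOL-Probability.Probability" "Graph_Theory.Graph_Theory"
begin

(* A pair_graph is a finite simple graph in which every undirected edge {u, v} is represented by
   the two arcs (u, v) and (v, u); hence parcs G is the set of directed edges, and the number of
   neighbours of a node is its out-degree. *)

definition regular_graph :: "'a pair_pre_digraph \<Rightarrow> nat \<Rightarrow> bool" where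
  "regular_graph G d \<longleftrightarrow> (\<forall>u \<in> pverts G. out_degree (with_proj G) u = d)"

(* The possible outcomes (v_1, ..., v_k) of drawing k neighbours of u without replacement; drawing
   them one after another uniformly at random is the uniform distribution on this set. *)

definition neighbour_samples :: "'a pair_pre_digraph \<Rightarrow> nat \<Rightarrow> 'a \<Rightarrow> 'a list set" where
  "neighbour_samples G k u =
     {vs. length vs = k \<and> distinct vs \<and> (\<forall>v \<in> set vs. (u, v) \<in> parcs G)}"

definition node_update :: "real \<Rightarrow> nat \<Rightarrow> 'a \<Rightarrow> 'a list \<Rightarrow> ('a \<Rightarrow> real) \<Rightarrow> 'a \<Rightarrow> real" where
  "node_update \<alpha> k u vs \<xi> = \<xi>(u := \<alpha> * \<xi> u + (1 - \<alpha>) / real k * (\<Sum>v\<leftarrow>vs. \<xi> v))"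

definition node_step ::
    "'a pair_pre_digraph \<Rightarrow> real \<Rightarrow> nat \<Rightarrow> ('a \<Rightarrow> real) \<Rightarrow> ('a \<Rightarrow> real) pmf" where
  "node_step G \<alpha> k \<xi> =
     bind_pmf (pmf_of_set (pverts G)) (\<lambda>u.
     bind_pmf (pmf_of_set (neighbour_samples G k u)) (\<lambda>vs.
     return_pmf (node_update \<alpha> k u vs \<xi>)))"

(* node_model G \<alpha> k \<xi>0 t is the law of \<xi>(t) when \<xi>(0) = \<xi>0. Values of a state outside
   pverts G are never read or changed. *)

primrec node_model ::
    "'a pair_pre_digraph \<Rightarrow> real \<Rightarrow> nat \<Rightarrow> ('a \<Rightarrow> real) \<Rightarrow> nat \<Rightarrow> ('a \<Rightarrow> real) pmf" where
  "node_model G \<alpha> k \<xi>0 0 = return_pmf \<xi>0"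
| "node_model G \<alpha> k \<xi>0 (Suc t) = bind_pmf (node_model G \<alpha> k \<xi>0 t) (node_step G \<alpha> k)"

definition avg :: "'a pair_pre_digraph \<Rightarrow> ('a \<Rightarrow> real) \<Rightarrow> real" where
  "avg G \<xi> = (\<Sum>u\<in>pverts G. \<xi> u) / real (card (pverts G))"

end

theory Submission
  imports Defs
begin

text \<open>
  Write \<open>S\<close> for the sum of the squares \<open>\<xi> u ^ 2\<close>, \<open>P\<close> for the sum of \<open>\<xi> u * \<xi> v\<close> over the
  directed edges, and \<open>T\<close> for the sum of all values. The numbers \<open>\<mu>0, \<mu>1, \<mu>p\<close> are the
  stationary probabilities of a pair of correlated random walks dual to the process: of each
  ordered pair of positions at distance 0, at distance 1 and further apart. Stationarity says that
  \<open>Q = (\<mu>0 - \<mu>p) S + (\<mu>1 - \<mu>p) P + \<mu>p T^2\<close> is a martingale along the process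
  (\<open>step_mean_dual_form\<close>); this is checked here directly, from the first two moments of a sample
  drawn without replacement. As \<open>T = 0\<close> initially, \<open>Q (\<xi> 0)\<close> is the main term of the claim.

  On a regular graph the average is a martingale as well, started at 0, so that its variance is
  the mean of its square and does not decrease in time. It therefore suffices to show that
  this mean converges to \<open>Q (\<xi> 0)\<close>: the limit bounds the variance from above at every
  time, and the variance comes within \<open>1 / n^5\<close> of it from some time on.

  For the convergence, \<open>Q - Avg^2\<close> vanishes on constant vectors; it is a combination of
  the spread \<open>S - T^2 / n\<close> and the Dirichlet energy, the sum of \<open>(\<xi> u - \<xi> v)^2\<close> over the
  directed edges (\<open>dual_form_eq_avg\<close>), and on a connected graph the energy controls the spread
  (\<open>poincare\<close>). The energy dissipates: in each step the mean of \<open>S\<close> drops by at least a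
  fixed multiple of the mean energy (\<open>step_mean_square_sum_le\<close>). As \<open>S\<close> is nonnegative,
  the mean energies are summable over time and tend to zero.
\<close>

section \<open>Moments of a sample drawn without replacement\<close>

definition draws :: "'a set \<Rightarrow> nat \<Rightarrow> 'a list set" where
  "draws N k = {vs. length vs = k \<and> distinct vs \<and> set vs \<subseteq> N}"

lemma draws_0 [simp]: "draws N 0 = {[]}"
  by (auto simp: draws_def)

lemma finite_draws: "finite N \<Longrightarrow> finite (draws N k)"
  unfolding draws_def
  by (rule finite_subset[OF _ finite_lists_length_eq[of N k]]) auto

lemma card_draws:
  assumes "finite N" "k \<le> card N"
  shows "card (draws N k) = \<Prod>{card N - k + 1..card N}"
  using card_lists_distinct_length_eq[OF assms] by (simp add: draws_def)

lemma draws_nonempty: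
  assumes "finite N" "k \<le> card N"
  shows "draws N k \<noteq> {}"
proof -
  have "card (draws N k) > 0"
    using card_draws[OF assms] by (auto simp: prod_pos)
  then show ?thesis by auto
qed

lemma bij_betw_draws_Suc:
  "bij_betw (\<lambda>(x, vs). x # vs) (SIGMA x:N. draws (N - {x}) k) (draws N (Suc k))"
proof (rule bij_betwI')
  show "\<exists>p\<in>SIGMA x:N. draws (N - {x}) k. vs = (case p of (x, vs) \<Rightarrow> x # vs)"
    if "vs \<in> draws N (Suc k)" for vs
    using that by (cases vs) (auto simp: draws_def)
qed (auto simp: draws_def)

abbreviation draw_mean :: "'a set \<Rightarrow> nat \<Rightarrow> ('a list \<Rightarrow> real) \<Rightarrow> real" where
  "draw_mean N k \<equiv> measure_pmf.expectation (pmf_of_set (draws N k))"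

text \<open>Sampling \<open>Suc k\<close> elements means drawing the first one uniformly and sampling the other \<open>k\<close>
  from what remains; the recursion is what both moments below are computed by.\<close>

lemma draw_mean_Suc:
  assumes "finite N" "k < card N"
  shows "draw_mean N (Suc k) h
    = (\<Sum>x\<in>N. draw_mean (N - {x}) k (\<lambda>vs. h (x # vs))) / real (card N)"
proof -
  define c where "c = \<Prod>{card N - 1 - k + 1..card N - 1}"
  have card: "card (draws (N - {x}) k) = c" if "x \<in> N" for x
    using card_draws[of "N - {x}" k] assms that by (simp add: c_def)
  have ne: "draws (N - {x}) k \<noteq> {}" "finite (draws (N - {x}) k)" if "x \<in> N" for x
    using draws_nonempty[of "N - {x}" k] assms that by (auto intro: finite_draws)
  have sum: "sum g (draws N (Suc k)) = (\<Sum>x\<in>N. \<Sum>vs\<in>draws (N - {x}) k. g (x # vs))"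
    for g :: "_ \<Rightarrow> real"
    using sum.reindex_bij_betw[OF bij_betw_draws_Suc, of g N k]
    by (simp add: sum.Sigma assms finite_draws case_prod_unfold)
  have "real (card (draws N (Suc k))) = real (card N) * real c"
    using sum[of "\<lambda>_. 1"] card by simp
  then show ?thesis
    using assms draws_nonempty[of N "Suc k"] ne card
    by (simp add: integral_pmf_of_set finite_draws sum sum_divide_distrib mult.commute)
qed

lemma integrable_draws [simp]:
  fixes h :: "'a list \<Rightarrow> real"
  assumes "finite N" "k \<le> card N"
  shows "integrable (measure_pmf (pmf_of_set (draws N k))) h"
  using assms by (intro integrable_measure_pmf_finite) (simp add: finite_draws draws_nonempty)

lemma draw_mean_sum:
  assumes "finite N" "k \<le> card N"
  shows "draw_mean N k (\<lambda>vs. \<Sum>v\<leftarrow>vs. f v) = real k / real (card N) * sum f N"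
  using assms
proof (induction k arbitrary: N)
  case 0
  then show ?case by (simp add: pmf_of_set_singleton)
next
  case (Suc k)
  define m where "m = real (card N)"
  have m: "m > 0" "real (card N - Suc 0) = m - 1"
    using Suc.prems by (auto simp: m_def of_nat_diff)
  have k0: "k = 0" if "m = 1" using that Suc.prems by (simp add: m_def)
  have "draw_mean N (Suc k) (\<lambda>vs. \<Sum>v\<leftarrow>vs. f v)
      = (\<Sum>x\<in>N. f x + real k / (m - 1) * (sum f N - f x)) / m"
    using Suc.prems Suc.IH[of "N - {_}"]
    by (simp add: draw_mean_Suc sum_diff1 m m_def[symmetric])
  also have "(\<Sum>x\<in>N. f x + c * (sum f N - f x)) = sum f N + c * (m * sum f N - sum f N)" for c
    by (simp add: sum.distrib sum_subtractf m_def flip: sum_distrib_left)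
  also have "(sum f N + real k / (m - 1) * (m * sum f N - sum f N)) / m
      = real (Suc k) / m * sum f N"
    using m k0 by (cases "m = 1") (auto simp: field_simps)
  finally show ?case by (simp add: m_def)
qed

text \<open>The second moment without its diagonal part. Unlike the full second moment, this
  has a formula that stays correct, with the convention \<open>x / 0 = 0\<close>, for populations of one element;
  the induction passes through such populations.\<close>

lemma draw_mean_cross:
  assumes "finite N" "k \<le> card N"
  shows "draw_mean N k (\<lambda>vs. (\<Sum>v\<leftarrow>vs. f v)\<^sup>2 - (\<Sum>v\<leftarrow>vs. (f v)\<^sup>2))
    = real k * (real k - 1) / (real (card N) * (real (card N) - 1))
      * ((sum f N)\<^sup>2 - (\<Sum>v\<in>N. (f v)\<^sup>2))"
  using assms
proof (induction k arbitrary: N)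
  case 0
  then show ?case by (simp add: pmf_of_set_singleton)
next
  case (Suc k)
  define m where "m = real (card N)"
  define F where "F = sum f N"
  define R where "R = (\<Sum>v\<in>N. (f v)\<^sup>2)"
  have m: "m > 0" "real (card N - Suc 0) = m - 1"
    using Suc.prems by (auto simp: m_def of_nat_diff)
  have k0: "k = 0" if "m = 1" using that Suc.prems by (simp add: m_def)
  have k1: "k \<le> 1" if "m = 2" using that Suc.prems by (simp add: m_def)
  define c1 where "c1 = real k / (m - 1)"
  define c2 where "c2 = real k * (real k - 1) / ((m - 1) * (m - 2))"
  have step: "draw_mean (N - {x}) k
        (\<lambda>vs. (\<Sum>v\<leftarrow>x # vs. f v)\<^sup>2 - (\<Sum>v\<leftarrow>x # vs. (f v)\<^sup>2))
      = c2 * ((F - f x)\<^sup>2 - (R - (f x)\<^sup>2)) + 2 * f x * (c1 * (F - f x))" if x: "x \<in> N" for x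
  proof -
    have card: "finite (N - {x})" "k \<le> card (N - {x})" "real (card (N - {x})) = m - 1"
      using Suc.prems x m by auto
    have sums: "sum f (N - {x}) = F - f x" "(\<Sum>v\<in>N - {x}. (f v)\<^sup>2) = R - (f x)\<^sup>2"
      using Suc.prems x by (simp_all add: sum_diff1 F_def R_def)
    have "draw_mean (N - {x}) k
        (\<lambda>vs. (\<Sum>v\<leftarrow>x # vs. f v)\<^sup>2 - (\<Sum>v\<leftarrow>x # vs. (f v)\<^sup>2))
      = draw_mean (N - {x}) k (\<lambda>vs. ((\<Sum>v\<leftarrow>vs. f v)\<^sup>2 - (\<Sum>v\<leftarrow>vs. (f v)\<^sup>2))
          + 2 * f x * (\<Sum>v\<leftarrow>vs. f v))"
      by (simp add: power2_sum algebra_simps)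
    also have "\<dots> = draw_mean (N - {x}) k (\<lambda>vs. (\<Sum>v\<leftarrow>vs. f v)\<^sup>2 - (\<Sum>v\<leftarrow>vs. (f v)\<^sup>2))
          + 2 * f x * draw_mean (N - {x}) k (\<lambda>vs. \<Sum>v\<leftarrow>vs. f v)"
      by (simp only: Bochner_Integration.integral_add integrable_draws[OF card(1,2)]
          integral_mult_right_zero)
    also note Suc.IH[OF card(1,2)]
    also note draw_mean_sum[OF card(1,2)]
    finally show ?thesis by (simp only: sums card(3) c1_def c2_def) (simp add: algebra_simps)
  qed
  have "draw_mean N (Suc k) (\<lambda>vs. (\<Sum>v\<leftarrow>vs. f v)\<^sup>2 - (\<Sum>v\<leftarrow>vs. (f v)\<^sup>2))
      = (\<Sum>x\<in>N. c2 * ((F - f x)\<^sup>2 - (R - (f x)\<^sup>2)) + 2 * f x * (c1 * (F - f x))) / m"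
    using Suc.prems
    by (simp only: draw_mean_Suc Suc_le_lessD step m_def cong: sum.cong)
  also have "(\<Sum>x\<in>N. c2 * ((F - f x)\<^sup>2 - (R - (f x)\<^sup>2)) + 2 * f x * (c1 * (F - f x)))
      = (\<Sum>x\<in>N. c2 * (F\<^sup>2 - R) + (2 * c1 - 2 * c2) * F * f x + (2 * c2 - 2 * c1) * (f x)\<^sup>2)"
    by (intro sum.cong refl) (simp add: power2_eq_square algebra_simps)
  also have "\<dots> = m * (c2 * (F\<^sup>2 - R)) + (2 * c1 - 2 * c2) * F * F + (2 * c2 - 2 * c1) * R"
    by (simp only: sum.distrib flip: sum_distrib_left) (simp add: m_def F_def R_def)
  also have "\<dots> = ((m - 2) * c2 + 2 * c1) * (F\<^sup>2 - R)"
    by (simp add: power2_eq_square algebra_simps)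
  also have "(m - 2) * c2 + 2 * c1 = real k * (real k + 1) / (m - 1)"
  proof -
    consider "m = 1" | "m = 2" | "m - 1 \<noteq> 0" "m - 2 \<noteq> 0" by force
    then show ?thesis
    proof cases
      case 2
      then have "k = 0 \<or> k = 1" using k1 by auto
      then show ?thesis using 2 by (auto simp: c1_def c2_def)
    next
      case 3
      then have "(m - 2) * c2 = real k * (real k - 1) / (m - 1)"
        by (simp add: c2_def)
      then show ?thesis
        by (simp add: c1_def algebra_simps flip: add_divide_distrib)
    qed (use k0 in \<open>simp add: c1_def c2_def\<close>)
  qed
  finally show ?case
    by (simp add: m_def F_def R_def ac_simps)
qed

lemma draw_mean_square:
  assumes "finite N" "k \<le> card N" "2 \<le> card N"
  shows "draw_mean N k (\<lambda>vs. (\<Sum>v\<leftarrow>vs. f v)\<^sup>2)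
    = real k * ((real (card N) - real k) * (\<Sum>v\<in>N. (f v)\<^sup>2) + (real k - 1) * (sum f N)\<^sup>2)
      / (real (card N) * (real (card N) - 1))"
proof -
  define m where "m = real (card N)"
  define F2 where "F2 = (sum f N)\<^sup>2"
  define R where "R = (\<Sum>v\<in>N. (f v)\<^sup>2)"
  have "draw_mean N k (\<lambda>vs. (\<Sum>v\<leftarrow>vs. f v)\<^sup>2)
      = draw_mean N k (\<lambda>vs. ((\<Sum>v\<leftarrow>vs. f v)\<^sup>2 - (\<Sum>v\<leftarrow>vs. (f v)\<^sup>2)) + (\<Sum>v\<leftarrow>vs. (f v)\<^sup>2))"
    by simp
  also have "\<dots> = draw_mean N k (\<lambda>vs. (\<Sum>v\<leftarrow>vs. f v)\<^sup>2 - (\<Sum>v\<leftarrow>vs. (f v)\<^sup>2))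
      + draw_mean N k (\<lambda>vs. \<Sum>v\<leftarrow>vs. (f v)\<^sup>2)"
    using assms by (intro Bochner_Integration.integral_add) auto
  also have "\<dots> = real k * (real k - 1) / (m * (m - 1)) * (F2 - R) + real k / m * R"
    using assms by (simp only: draw_mean_cross draw_mean_sum m_def F2_def R_def)
  also have "real k / m = real k * (m - 1) / (m * (m - 1))"
    using assms by (simp add: m_def)
  also have "real k * (real k - 1) / (m * (m - 1)) * (F2 - R) + real k * (m - 1) / (m * (m - 1)) * R
      = (real k * (real k - 1) * (F2 - R) + real k * (m - 1) * R) / (m * (m - 1))"
    by (simp only: add_divide_distrib times_divide_eq_left)
  also have "real k * (real k - 1) * (F2 - R) + real k * (m - 1) * R
      = real k * ((m - real k) * R + (real k - 1) * F2)"
    by (simp add: algebra_simps)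
  finally show ?thesis
    by (simp only: m_def F2_def R_def)
qed



section \<open>The graph and its quadratic forms\<close>

locale regular_node_model = pair_graph G
  for G :: "'a pair_pre_digraph" +
  fixes d k :: nat and \<alpha> :: real
  assumes regular: "regular_graph G d"
    and conn: "Digraph_Component.connected (with_proj G)"
    and d_ge_2: "2 \<le> d"
    and k_pos: "1 \<le> k" and k_le_d: "k \<le> d"
    and \<alpha>_pos: "0 < \<alpha>" and \<alpha>_less_1: "\<alpha> < 1"
begin

abbreviation V :: "'a set" where "V \<equiv> pverts G"

abbreviation n :: real where "n \<equiv> real (card V)"

definition nbrs :: "'a \<Rightarrow> 'a set" where "nbrs u = {v. (u, v) \<in> parcs G}"

definition total :: "('a \<Rightarrow> real) \<Rightarrow> real" where
  "total \<xi> = (\<Sum>u\<in>V. \<xi> u)"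

definition square_sum :: "('a \<Rightarrow> real) \<Rightarrow> real" where
  "square_sum \<xi> = (\<Sum>u\<in>V. (\<xi> u)\<^sup>2)"

definition nbr_sum :: "('a \<Rightarrow> real) \<Rightarrow> 'a \<Rightarrow> real" where
  "nbr_sum \<xi> u = (\<Sum>v\<in>nbrs u. \<xi> v)"

definition edge_sum :: "('a \<Rightarrow> real) \<Rightarrow> real" where
  "edge_sum \<xi> = (\<Sum>u\<in>V. \<xi> u * nbr_sum \<xi> u)"

definition dirichlet :: "('a \<Rightarrow> real) \<Rightarrow> real" where
  "dirichlet \<xi> = (\<Sum>u\<in>V. \<Sum>v\<in>nbrs u. (\<xi> u - \<xi> v)\<^sup>2)"

lemma V_nonempty: "V \<noteq> {}"
  using conn by (simp add: connected_conv)

lemma n_pos: "n > 0"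
  using V_nonempty pair_finite_verts by (simp add: card_gt_0_iff)

lemma nbrs_subset: "nbrs u \<subseteq> V"
  by (auto simp: nbrs_def dest: in_arcsD2)

lemma finite_nbrs [simp]: "finite (nbrs u)"
  using finite_subset[OF nbrs_subset pair_finite_verts] .

lemma nbrs_sym: "v \<in> nbrs u \<longleftrightarrow> u \<in> nbrs v"
  by (auto simp: nbrs_def intro: arcs_symmetric)

lemma not_self_nbr [simp]: "u \<notin> nbrs u"
  by (auto simp: nbrs_def dest: no_loops')

lemma card_nbrs:
  assumes "u \<in> V"
  shows "card (nbrs u) = d"
proof -
  have "out_arcs (with_proj G) u = Pair u ` nbrs u"
    by (auto simp: out_arcs_def nbrs_def)
  then have "card (nbrs u) = out_degree (with_proj G) u"
    by (simp add: out_degree_def card_image inj_on_def)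
  then show ?thesis using regular assms by (simp add: regular_graph_def)
qed

lemma sum_parcs: "(\<Sum>(u, v)\<in>parcs G. f u v) = (\<Sum>u\<in>V. \<Sum>v\<in>nbrs u. f u v)"
proof -
  have "parcs G = Sigma V nbrs"
    by (auto simp: nbrs_def dest: in_arcsD1)
  then show ?thesis by (simp add: sum.Sigma pair_finite_verts)
qed

text \<open>Reversal of the directed edges.\<close>

lemma sum_nbrs_swap: "(\<Sum>u\<in>V. \<Sum>v\<in>nbrs u. f u v) = (\<Sum>u\<in>V. \<Sum>v\<in>nbrs u. f v u)"
proof -
  have "(\<Sum>u\<in>V. \<Sum>v\<in>nbrs u. f u v) = (\<Sum>v\<in>V. \<Sum>u\<in>{u \<in> V. v \<in> nbrs u}. f u v)"
    using sum.swap_restrict[OF pair_finite_verts pair_finite_verts, of f "\<lambda>u v. v \<in> nbrs u"] nbrs_subset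
    by (simp add: Collect_conj_eq Int_absorb1)
  also have "\<dots> = (\<Sum>v\<in>V. \<Sum>u\<in>nbrs v. f u v)"
    using nbrs_subset nbrs_sym by (intro sum.cong refl) blast
  finally show ?thesis .
qed

lemma sum_nbrs_const: "(\<Sum>u\<in>V. \<Sum>v\<in>nbrs u. f u) = real d * (\<Sum>u\<in>V. f u)"
  by (simp add: card_nbrs sum_distrib_left)

lemma sum_nbr_sum: "(\<Sum>u\<in>V. nbr_sum \<xi> u) = real d * total \<xi>"
  unfolding nbr_sum_def total_def
  by (subst sum_nbrs_swap) (rule sum_nbrs_const)

lemma edge_sum_eq_arcs: "edge_sum \<xi> = (\<Sum>(u, v)\<in>parcs G. \<xi> u * \<xi> v)"
  by (simp add: sum_parcs edge_sum_def nbr_sum_def sum_distrib_left)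

lemma dirichlet_eq: "dirichlet \<xi> = 2 * (real d * square_sum \<xi> - edge_sum \<xi>)"
proof -
  have "dirichlet \<xi> = (\<Sum>u\<in>V. \<Sum>v\<in>nbrs u. (\<xi> u)\<^sup>2) + (\<Sum>u\<in>V. \<Sum>v\<in>nbrs u. (\<xi> v)\<^sup>2) - 2 * edge_sum \<xi>"
    unfolding dirichlet_def edge_sum_def nbr_sum_def
    by (simp add: power2_diff sum.distrib sum_subtractf sum_distrib_left mult.assoc)
  moreover have "(\<Sum>u\<in>V. \<Sum>v\<in>nbrs u. (\<xi> v)\<^sup>2) = (\<Sum>u\<in>V. \<Sum>v\<in>nbrs u. (\<xi> u)\<^sup>2)"
    by (rule sum_nbrs_swap)
  ultimately show ?thesis
    by (simp only: sum_nbrs_const square_sum_def) simp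
qed

lemma dirichlet_nonneg: "0 \<le> dirichlet \<xi>"
  unfolding dirichlet_def by (intro sum_nonneg) auto

lemma square_sum_nonneg: "0 \<le> square_sum \<xi>"
  unfolding square_sum_def by (intro sum_nonneg) auto

section \<open>A Poincare inequality\<close>

lemma arc_le_dirichlet:
  assumes "v \<in> nbrs u"
  shows "(\<xi> u - \<xi> v)\<^sup>2 \<le> dirichlet \<xi>"
proof -
  have "u \<in> V" using assms nbrs_sym nbrs_subset by blast
  have "(\<xi> u - \<xi> v)\<^sup>2 \<le> (\<Sum>v\<in>nbrs u. (\<xi> u - \<xi> v)\<^sup>2)"
    using assms by (intro member_le_sum) auto
  also have "\<dots> \<le> dirichlet \<xi>"
    unfolding dirichlet_def using \<open>u \<in> V\<close> pair_finite_verts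
    by (intro member_le_sum[of u V "\<lambda>u. \<Sum>v\<in>nbrs u. (\<xi> u - \<xi> v)\<^sup>2"]) (auto intro: sum_nonneg)
  finally show ?thesis .
qed

text \<open>Connectedness enters here: \<open>u\<close> and \<open>v\<close> are joined by a path, and \<open>(a + b)^2 \<le> 2 a^2 + 2 b^2\<close>
  extends the bound along it, edge by edge. Only the existence of a constant matters, not its size.\<close>

lemma pair_le_dirichlet:
  assumes "u \<in> V" "v \<in> V"
  shows "\<exists>C\<ge>0. \<forall>\<xi>. (\<xi> u - \<xi> v)\<^sup>2 \<le> C * dirichlet \<xi>"
proof -
  have "(u, v) \<in> rtrancl_on V ((parcs G)\<^sup>s)"
    using conn assms by (simp add: connected_conv)
  then show ?thesis
  proof (induction rule: rtrancl_on_induct)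
    case base
    then show ?case by (intro exI[of _ 0]) simp
  next
    case (step y z)
    then obtain C where C: "C \<ge> 0" "\<And>\<xi>. (\<xi> u - \<xi> y)\<^sup>2 \<le> C * dirichlet \<xi>" by blast
    have "z \<in> nbrs y"
      using step by (auto simp: symcl_def nbrs_def intro: arcs_symmetric)
    have "(\<xi> u - \<xi> z)\<^sup>2 \<le> (2 * C + 2) * dirichlet \<xi>" for \<xi>
    proof -
      have "(\<xi> u - \<xi> z)\<^sup>2 \<le> 2 * (\<xi> u - \<xi> y)\<^sup>2 + 2 * (\<xi> y - \<xi> z)\<^sup>2"
        using zero_le_power2[of "(\<xi> u - \<xi> y) - (\<xi> y - \<xi> z)"]
        by (simp add: power2_eq_square algebra_simps)
      also have "\<dots> \<le> 2 * (C * dirichlet \<xi>) + 2 * dirichlet \<xi>"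
        using C(2)[of \<xi>] arc_le_dirichlet[OF \<open>z \<in> nbrs y\<close>, of \<xi>] by linarith
      finally show ?thesis by (simp add: algebra_simps)
    qed
    then show ?case using C(1) by (intro exI[of _ "2 * C + 2"]) simp
  qed
qed

text \<open>The sum of the squared deviations from the average.\<close>

definition spread :: "('a \<Rightarrow> real) \<Rightarrow> real" where
  "spread \<xi> = square_sum \<xi> - (total \<xi>)\<^sup>2 / n"

lemma spread_nonneg: "0 \<le> spread \<xi>"
  using sum_squared_le_sum_of_squares[of \<xi> V] n_pos
  by (simp add: spread_def square_sum_def total_def field_simps)

lemma poincare: "\<exists>C\<ge>0. \<forall>\<xi>. spread \<xi> \<le> C * dirichlet \<xi>"
proof -
  obtain r where r: "r \<in> V" using V_nonempty by blast
  have "\<forall>u\<in>V. \<exists>C\<ge>0. \<forall>\<xi>. (\<xi> u - \<xi> r)\<^sup>2 \<le> C * dirichlet \<xi>"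
    using pair_le_dirichlet r by blast
  then obtain C where C: "\<And>u. u \<in> V \<Longrightarrow> C u \<ge> 0"
      "\<And>u \<xi>. u \<in> V \<Longrightarrow> (\<xi> u - \<xi> r)\<^sup>2 \<le> C u * dirichlet \<xi>"
    by metis
  have "spread \<xi> \<le> sum C V * dirichlet \<xi>" for \<xi>
  proof -
    \<comment> \<open>The sum of the squared deviations from \<open>c\<close> is least when \<open>c\<close> is the average.\<close>
    have "(\<Sum>u\<in>V. (\<xi> u - \<xi> r)\<^sup>2) - spread \<xi> = (total \<xi> - n * \<xi> r)\<^sup>2 / n"
    proof -
      have eq: "(\<Sum>u\<in>V. (\<xi> u - \<xi> r)\<^sup>2) = square_sum \<xi> + n * (\<xi> r)\<^sup>2 - 2 * total \<xi> * \<xi> r"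
        by (simp add: square_sum_def total_def power2_diff sum.distrib sum_subtractf
            flip: sum_distrib_left sum_distrib_right)
      show ?thesis
        unfolding eq spread_def using V_nonempty pair_finite_verts
        by (simp add: field_simps power2_eq_square)
    qed
    then have "spread \<xi> \<le> (\<Sum>u\<in>V. (\<xi> u - \<xi> r)\<^sup>2)"
      using n_pos by (smt (verit) divide_nonneg_pos zero_le_power2)
    also have "\<dots> \<le> (\<Sum>u\<in>V. C u * dirichlet \<xi>)"
      using C by (intro sum_mono) auto
    finally show ?thesis by (simp add: sum_distrib_right)
  qed
  then show ?thesis using C by (intro exI[of _ "sum C V"]) (auto intro: sum_nonneg)
qed

section \<open>Effect of changing a single value\<close>

lemma total_update:
  assumes "u \<in> V"
  shows "total (\<xi>(u := y)) = total \<xi> + (y - \<xi> u)"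
  using assms pair_finite_verts by (simp add: total_def sum.remove[of V u])

lemma square_sum_update:
  assumes "u \<in> V"
  shows "square_sum (\<xi>(u := y)) = square_sum \<xi> + 2 * \<xi> u * (y - \<xi> u) + (y - \<xi> u)\<^sup>2"
  using assms pair_finite_verts
  by (simp add: square_sum_def sum.remove[of V u]) (simp add: power2_eq_square algebra_simps)

text \<open>There is no term in \<open>(y - \<xi> u)^2\<close>, as no node is its own neighbour.\<close>

lemma edge_sum_update:
  assumes u: "u \<in> V"
  shows "edge_sum (\<xi>(u := y)) = edge_sum \<xi> + 2 * nbr_sum \<xi> u * (y - \<xi> u)"
proof -
  define \<delta> where "\<delta> = y - \<xi> u"
  have nbr: "nbr_sum (\<xi>(u := y)) w = nbr_sum \<xi> w + (if w \<in> nbrs u then \<delta> else 0)" for w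
  proof -
    have "nbr_sum (\<xi>(u := y)) w = (\<Sum>v\<in>nbrs w. \<xi> v + (if v = u then \<delta> else 0))"
      unfolding nbr_sum_def by (intro sum.cong) (auto simp: \<delta>_def)
    then show ?thesis
      by (simp add: sum.distrib nbr_sum_def nbrs_sym[of w u])
  qed
  have "edge_sum (\<xi>(u := y)) = (\<Sum>w\<in>V. \<xi> w * nbr_sum \<xi> w
      + (if w = u then \<delta> * nbr_sum \<xi> w else 0) + (if w \<in> nbrs u then \<delta> * \<xi> w else 0))"
    unfolding edge_sum_def nbr by (intro sum.cong) (auto simp: \<delta>_def algebra_simps)
  also have "\<dots> = edge_sum \<xi> + \<delta> * nbr_sum \<xi> u + (\<Sum>w\<in>V. if w \<in> nbrs u then \<delta> * \<xi> w else 0)"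
    using u by (simp add: sum.distrib edge_sum_def pair_finite_verts)
  also have "(\<Sum>w\<in>V. if w \<in> nbrs u then \<delta> * \<xi> w else 0) = \<delta> * nbr_sum \<xi> u"
    using nbrs_subset[of u]
    by (simp add: sum.If_cases pair_finite_verts Int_absorb1 nbr_sum_def sum_distrib_left)
  also have "edge_sum \<xi> + \<delta> * nbr_sum \<xi> u + \<delta> * nbr_sum \<xi> u
      = edge_sum \<xi> + 2 * nbr_sum \<xi> u * \<delta>"
    by simp
  finally show ?thesis by (simp only: \<delta>_def)
qed

section \<open>Means after one step\<close>

abbreviation step_mean :: "('a \<Rightarrow> real) \<Rightarrow> (('a \<Rightarrow> real) \<Rightarrow> real) \<Rightarrow> real" where
  "step_mean \<xi> h \<equiv> measure_pmf.expectation (node_step G \<alpha> k \<xi>) h"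

lemma neighbour_samples_eq: "neighbour_samples G k u = draws (nbrs u) k"
  by (auto simp: neighbour_samples_def draws_def nbrs_def)

lemma samples:
  assumes "u \<in> V"
  shows "finite (draws (nbrs u) k)" "draws (nbrs u) k \<noteq> {}"
  using k_le_d card_nbrs[OF assms] draws_nonempty[of "nbrs u" k] by (simp_all add: finite_draws)

lemma finite_set_node_step: "finite (set_pmf (node_step G \<alpha> k \<xi>))"
  by (auto simp: node_step_def neighbour_samples_eq V_nonempty pair_finite_verts samples)

lemma step_mean_eq:
  "step_mean \<xi> h = (\<Sum>u\<in>V. draw_mean (nbrs u) k (\<lambda>vs. h (node_update \<alpha> k u vs \<xi>))) / n"
proof -
  have "step_mean \<xi> h = (\<Sum>u\<in>V. measure_pmf.expectation (pmf_of_set (neighbour_samples G k u)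
      \<bind> (\<lambda>vs. return_pmf (node_update \<alpha> k u vs \<xi>))) h /\<^sub>R real (card V))"
    unfolding node_step_def
    using V_nonempty pair_finite_verts
    by (intro pmf_expectation_bind_pmf_of_set) (auto simp: neighbour_samples_eq samples)
  also have "\<dots> = (\<Sum>u\<in>V. draw_mean (nbrs u) k (\<lambda>vs. h (node_update \<alpha> k u vs \<xi>)) /\<^sub>R real (card V))"
    by (simp add: neighbour_samples_eq map_pmf_def[symmetric] integral_map_pmf)
  finally show ?thesis
    by (simp add: divide_inverse sum_distrib_left mult.commute)
qed

text \<open>The mean squared change of the value at \<open>u\<close>, given that \<open>u\<close> is the node chosen
  (\<open>draw_mean_incr_square\<close>).\<close>

definition step_var :: "('a \<Rightarrow> real) \<Rightarrow> 'a \<Rightarrow> real" where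
  "step_var \<xi> u = (1 - \<alpha>)\<^sup>2 *
     (((real d - real k) * nbr_sum (\<lambda>v. (\<xi> v)\<^sup>2) u + (real k - 1) * (nbr_sum \<xi> u)\<^sup>2)
        / (real k * (real d * (real d - 1)))
      - 2 * \<xi> u * (nbr_sum \<xi> u / real d) + (\<xi> u)\<^sup>2)"

abbreviation incr :: "('a \<Rightarrow> real) \<Rightarrow> 'a \<Rightarrow> 'a list \<Rightarrow> real" where
  "incr \<xi> u vs \<equiv> node_update \<alpha> k u vs \<xi> u - \<xi> u"

lemma incr_eq: "incr \<xi> u vs = (1 - \<alpha>) * ((\<Sum>v\<leftarrow>vs. \<xi> v) / real k - \<xi> u)"
  by (simp add: node_update_def algebra_simps)

lemma draw_mean_incr:
  assumes "u \<in> V"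
  shows "draw_mean (nbrs u) k (incr \<xi> u) = (1 - \<alpha>) * (nbr_sum \<xi> u / real d - \<xi> u)"
proof -
  have int: "integrable (measure_pmf (pmf_of_set (draws (nbrs u) k))) h" for h :: "_ \<Rightarrow> real"
    using assms k_le_d by (intro integrable_draws) (auto simp: card_nbrs)
  have "draw_mean (nbrs u) k (incr \<xi> u)
      = (1 - \<alpha>) * (draw_mean (nbrs u) k (\<lambda>vs. \<Sum>v\<leftarrow>vs. \<xi> v) / real k - \<xi> u)"
    unfolding incr_eq by (simp add: int)
  then show ?thesis
    using assms k_le_d k_pos by (simp add: draw_mean_sum card_nbrs nbr_sum_def)
qed

lemma draw_mean_incr_square:
  assumes "u \<in> V"
  shows "draw_mean (nbrs u) k (\<lambda>vs. (incr \<xi> u vs)\<^sup>2) = step_var \<xi> u"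
proof -
  have int: "integrable (measure_pmf (pmf_of_set (draws (nbrs u) k))) h" for h :: "_ \<Rightarrow> real"
    using assms k_le_d by (intro integrable_draws) (auto simp: card_nbrs)
  have sq: "(incr \<xi> u vs)\<^sup>2 = (1 - \<alpha>)\<^sup>2 * ((\<Sum>v\<leftarrow>vs. \<xi> v)\<^sup>2 / (real k)\<^sup>2
        - 2 * \<xi> u / real k * (\<Sum>v\<leftarrow>vs. \<xi> v) + (\<xi> u)\<^sup>2)" for vs
    unfolding incr_eq by (simp add: power_mult_distrib power2_diff power_divide)
  have "draw_mean (nbrs u) k (\<lambda>vs. (incr \<xi> u vs)\<^sup>2)
      = (1 - \<alpha>)\<^sup>2 * (draw_mean (nbrs u) k (\<lambda>vs. (\<Sum>v\<leftarrow>vs. \<xi> v)\<^sup>2) / (real k)\<^sup>2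
        - 2 * \<xi> u / real k * draw_mean (nbrs u) k (\<lambda>vs. \<Sum>v\<leftarrow>vs. \<xi> v) + (\<xi> u)\<^sup>2)"
    unfolding sq by (simp add: int)
  moreover have "draw_mean (nbrs u) k (\<lambda>vs. (\<Sum>v\<leftarrow>vs. \<xi> v)\<^sup>2) / (real k)\<^sup>2
      = ((real d - real k) * nbr_sum (\<lambda>v. (\<xi> v)\<^sup>2) u + (real k - 1) * (nbr_sum \<xi> u)\<^sup>2)
        / (real k * (real d * (real d - 1)))"
    using assms k_le_d k_pos d_ge_2
    by (simp add: draw_mean_square card_nbrs nbr_sum_def power2_eq_square[of "real k"])
  moreover have "2 * \<xi> u / real k * draw_mean (nbrs u) k (\<lambda>vs. \<Sum>v\<leftarrow>vs. \<xi> v)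
      = 2 * \<xi> u * (nbr_sum \<xi> u / real d)"
    using assms k_le_d k_pos by (simp add: draw_mean_sum card_nbrs nbr_sum_def)
  ultimately show ?thesis by (simp add: step_var_def)
qed

text \<open>All one-step means needed are those of functions that depend quadratically on the value at
  the updated node, so they are determined by the first two moments of its change.\<close>

lemma step_mean_quadratic:
  assumes h: "\<And>u y. u \<in> V \<Longrightarrow> h (\<xi>(u := y)) = h \<xi> + a u * (y - \<xi> u) + b * (y - \<xi> u)\<^sup>2"
  shows "step_mean \<xi> h = h \<xi>
    + ((\<Sum>u\<in>V. a u * ((1 - \<alpha>) * (nbr_sum \<xi> u / real d - \<xi> u))) + b * (\<Sum>u\<in>V. step_var \<xi> u)) / n"
proof -
  have "draw_mean (nbrs u) k (\<lambda>vs. h (node_update \<alpha> k u vs \<xi>))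
      = h \<xi> + a u * ((1 - \<alpha>) * (nbr_sum \<xi> u / real d - \<xi> u)) + b * step_var \<xi> u"
    if u: "u \<in> V" for u
  proof -
    have int: "integrable (measure_pmf (pmf_of_set (draws (nbrs u) k))) h" for h :: "_ \<Rightarrow> real"
      using u k_le_d by (intro integrable_draws) (auto simp: card_nbrs)
    have "h (node_update \<alpha> k u vs \<xi>) = h \<xi> + a u * incr \<xi> u vs + b * (incr \<xi> u vs)\<^sup>2" for vs
      using h[OF u, of "node_update \<alpha> k u vs \<xi> u"] by (simp add: node_update_def)
    then have "draw_mean (nbrs u) k (\<lambda>vs. h (node_update \<alpha> k u vs \<xi>))
        = draw_mean (nbrs u) k (\<lambda>vs. h \<xi> + a u * incr \<xi> u vs + b * (incr \<xi> u vs)\<^sup>2)"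
      by simp
    also have "\<dots> = h \<xi> + a u * draw_mean (nbrs u) k (incr \<xi> u)
        + b * draw_mean (nbrs u) k (\<lambda>vs. (incr \<xi> u vs)\<^sup>2)"
      by (simp only: Bochner_Integration.integral_add int integral_mult_right_zero)
         simp
    finally show ?thesis using u by (simp only: draw_mean_incr draw_mean_incr_square)
  qed
  then show ?thesis
    using n_pos V_nonempty by (simp add: step_mean_eq sum.distrib add_divide_distrib flip: sum_distrib_left)
qed

text \<open>By regularity every node occurs in equally many neighbour sums, which makes the total
  a martingale.\<close>

lemma sum_drift: "(\<Sum>u\<in>V. (nbr_sum \<xi> u / real d - \<xi> u)) = 0"
  using d_ge_2 by (simp add: sum_subtractf sum_nbr_sum total_def flip: sum_divide_distrib)

definition nbr_square_sum :: "('a \<Rightarrow> real) \<Rightarrow> real" where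
  "nbr_square_sum \<xi> = (\<Sum>u\<in>V. (nbr_sum \<xi> u)\<^sup>2)"

lemma sum_step_var:
  "(\<Sum>u\<in>V. step_var \<xi> u) = (1 - \<alpha>)\<^sup>2 *
     ((real d * (real d - real k) * square_sum \<xi> + (real k - 1) * nbr_square_sum \<xi>)
        / (real k * (real d * (real d - 1)))
      - 2 * edge_sum \<xi> / real d + square_sum \<xi>)"
proof -
  have "(\<Sum>u\<in>V. nbr_sum (\<lambda>v. (\<xi> v)\<^sup>2) u) = real d * square_sum \<xi>"
    by (simp add: sum_nbr_sum) (simp add: total_def square_sum_def)
  then show ?thesis
    unfolding step_var_def
    by (simp add: sum.distrib sum_subtractf mult.assoc edge_sum_def nbr_square_sum_def square_sum_def
        flip: sum_distrib_left sum_divide_distrib)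
qed

lemma step_var_nonneg:
  assumes "u \<in> V"
  shows "0 \<le> step_var \<xi> u"
  by (subst draw_mean_incr_square[OF assms, symmetric]) simp

lemma step_mean_total: "step_mean \<xi> total = total \<xi>"
  using step_mean_quadratic[of total \<xi> "\<lambda>_. 1" 0]
  by (simp add: total_update sum_drift flip: sum_distrib_left)

lemma step_mean_total_square:
  "step_mean \<xi> (\<lambda>\<xi>. (total \<xi>)\<^sup>2) = (total \<xi>)\<^sup>2 + (\<Sum>u\<in>V. step_var \<xi> u) / n"
proof -
  have upd: "(total (\<xi>(u := y)))\<^sup>2 = (total \<xi>)\<^sup>2 + 2 * total \<xi> * (y - \<xi> u) + 1 * (y - \<xi> u)\<^sup>2"
    if "u \<in> V" for u y
    unfolding total_update[OF that] by (simp add: power2_sum)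
  have "step_mean \<xi> (\<lambda>\<xi>. (total \<xi>)\<^sup>2) = (total \<xi>)\<^sup>2
      + ((\<Sum>u\<in>V. 2 * total \<xi> * ((1 - \<alpha>) * (nbr_sum \<xi> u / real d - \<xi> u)))
         + 1 * (\<Sum>u\<in>V. step_var \<xi> u)) / n"
    by (rule step_mean_quadratic) (rule upd)
  then show ?thesis
    by (simp only: sum_drift flip: sum_distrib_left) simp
qed

lemma sum_drift_weighted:
  "(\<Sum>u\<in>V. (2 * a * \<xi> u + 2 * b * nbr_sum \<xi> u + c) * ((1 - \<alpha>) * (nbr_sum \<xi> u / real d - \<xi> u)))
    = 2 * (1 - \<alpha>) * (a * (edge_sum \<xi> / real d - square_sum \<xi>)
        + b * (nbr_square_sum \<xi> / real d - edge_sum \<xi>))"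
proof -
  have "(\<Sum>u\<in>V. (2 * a * \<xi> u + 2 * b * nbr_sum \<xi> u + c) * ((1 - \<alpha>) * (nbr_sum \<xi> u / real d - \<xi> u)))
      = (\<Sum>u\<in>V. 2 * (1 - \<alpha>) * a * (\<xi> u * nbr_sum \<xi> u / real d - (\<xi> u)\<^sup>2)
          + 2 * (1 - \<alpha>) * b * ((nbr_sum \<xi> u)\<^sup>2 / real d - \<xi> u * nbr_sum \<xi> u)
          + c * (1 - \<alpha>) * (nbr_sum \<xi> u / real d - \<xi> u))"
    by (intro sum.cong refl)
       (simp add: power2_eq_square algebra_simps add_divide_distrib diff_divide_distrib)
  also have "\<dots> = 2 * (1 - \<alpha>) * a * (edge_sum \<xi> / real d - square_sum \<xi>)
      + 2 * (1 - \<alpha>) * b * (nbr_square_sum \<xi> / real d - edge_sum \<xi>)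
      + c * (1 - \<alpha>) * (\<Sum>u\<in>V. nbr_sum \<xi> u / real d - \<xi> u)"
    by (simp only: sum.distrib sum_subtractf edge_sum_def square_sum_def nbr_square_sum_def
        sum_divide_distrib flip: sum_distrib_left)
  finally show ?thesis
    by (simp only: sum_drift) (simp add: distrib_left mult.assoc)
qed

text \<open>By the Cauchy-Schwarz inequality the mean square of a sample mean is at most the mean of the
  squares over all neighbours, whatever the sample size; equality holds for \<open>k = 1\<close>.\<close>

lemma sum_step_var_le:
  "(\<Sum>u\<in>V. step_var \<xi> u) \<le> (1 - \<alpha>)\<^sup>2 * (dirichlet \<xi> / real d)"
proof -
  have "nbr_square_sum \<xi> \<le> (\<Sum>u\<in>V. real d * nbr_sum (\<lambda>v. (\<xi> v)\<^sup>2) u)"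
    unfolding nbr_square_sum_def
  proof (rule sum_mono)
    show "(nbr_sum \<xi> u)\<^sup>2 \<le> real d * nbr_sum (\<lambda>v. (\<xi> v)\<^sup>2) u" if "u \<in> V" for u
      using sum_squared_le_sum_of_squares[of \<xi> "nbrs u"] card_nbrs[OF that]
      by (simp add: nbr_sum_def mult.commute)
  qed
  also have "\<dots> = real d * (real d * square_sum \<xi>)"
    by (simp add: sum_nbr_sum flip: sum_distrib_left) (simp add: total_def square_sum_def)
  finally have "(real k - 1) * nbr_square_sum \<xi> \<le> (real k - 1) * (real d * (real d * square_sum \<xi>))"
    using k_pos by (intro mult_left_mono) auto
  then have "real d * (real d - real k) * square_sum \<xi> + (real k - 1) * nbr_square_sum \<xi>
      \<le> square_sum \<xi> * (real k * (real d * (real d - 1)))"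
    by (simp add: algebra_simps)
  then have "(real d * (real d - real k) * square_sum \<xi> + (real k - 1) * nbr_square_sum \<xi>)
        / (real k * (real d * (real d - 1))) \<le> square_sum \<xi>"
    using k_pos d_ge_2 by (subst pos_divide_le_eq) auto
  then have "(real d * (real d - real k) * square_sum \<xi> + (real k - 1) * nbr_square_sum \<xi>)
        / (real k * (real d * (real d - 1))) - 2 * edge_sum \<xi> / real d + square_sum \<xi>
      \<le> dirichlet \<xi> / real d"
    using d_ge_2 by (simp add: dirichlet_eq diff_divide_distrib)
  then show ?thesis
    unfolding sum_step_var by (intro mult_left_mono) auto
qed

text \<open>Dissipation. The drift towards the neighbours lowers the sum of squares by
  \<open>(1 - \<alpha>) / (n d)\<close> times the Dirichlet energy, and the squared changes give back at most
  \<open>(1 - \<alpha>)^2 / (n d)\<close> times it.\<close>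

lemma step_mean_square_sum_le:
  "step_mean \<xi> square_sum \<le> square_sum \<xi> - \<alpha> * (1 - \<alpha>) / (n * real d) * dirichlet \<xi>"
proof -
  have "step_mean \<xi> square_sum = square_sum \<xi>
      + ((\<Sum>u\<in>V. (2 * 1 * \<xi> u + 2 * 0 * nbr_sum \<xi> u + 0) * ((1 - \<alpha>) * (nbr_sum \<xi> u / real d - \<xi> u)))
         + 1 * (\<Sum>u\<in>V. step_var \<xi> u)) / n"
    by (rule step_mean_quadratic) (simp add: square_sum_update)
  also have "\<dots> = square_sum \<xi> + (- (1 - \<alpha>) * (dirichlet \<xi> / real d) + (\<Sum>u\<in>V. step_var \<xi> u)) / n"
    unfolding sum_drift_weighted using d_ge_2
    by (simp add: dirichlet_eq diff_divide_distrib algebra_simps)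
  also have "\<dots> \<le> square_sum \<xi>
      + (- (1 - \<alpha>) * (dirichlet \<xi> / real d) + (1 - \<alpha>)\<^sup>2 * (dirichlet \<xi> / real d)) / n"
    using n_pos sum_step_var_le[of \<xi>] by (intro add_left_mono divide_right_mono) auto
  also have "- (1 - \<alpha>) * D + (1 - \<alpha>)\<^sup>2 * D = - (\<alpha> * (1 - \<alpha>)) * D" for D
    by (simp add: power2_eq_square algebra_simps)
  finally show ?thesis by (simp add: mult.commute)
qed

section \<open>The dual martingale\<close>

definition \<gamma> :: real where "\<gamma> = real k * (1 + \<alpha>) - (1 - \<alpha>)"

text \<open>The unnormalised stationary weights of an ordered pair of dual walkers at
  distance 0, at distance 1, and further apart.\<close>

definition w0 :: real where "w0 = 2 * real k * (real d - 1)"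
definition w1 :: real where "w1 = (real d - 1) * \<gamma>"
definition w2 :: real where "w2 = real d * \<gamma> - 2 * \<alpha> * real k"

text \<open>The total of the weights over all ordered pairs of nodes, after simplification; it is also the
  value of the dual form on the constant vector 1.\<close>

definition weight_sum :: real where
  "weight_sum = n * (n * w2 + 2 * (1 - \<alpha>) * (real d - real k))"

text \<open>The sum of \<open>\<xi> u * \<xi> v\<close> over all ordered pairs of nodes, each with its weight; the weight \<open>w2\<close> is
  collected in the square of the total, which leaves the differences from \<open>w2\<close> on the diagonal and
  on the edges.\<close>

definition dual_form :: "('a \<Rightarrow> real) \<Rightarrow> real" where
  "dual_form \<xi> = (w0 - w2) * square_sum \<xi> + (w1 - w2) * edge_sum \<xi> + w2 * (total \<xi>)\<^sup>2"

lemma w0_minus_w2: "w0 - w2 = (1 - \<alpha>) * (real k * real d - 2 * real k + real d)"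
  by (simp add: w0_def w2_def \<gamma>_def algebra_simps)

lemma w1_minus_w2: "w1 - w2 = - (1 - \<alpha>) * (real k - 1)"
  by (simp add: w1_def w2_def \<gamma>_def algebra_simps)

lemma dual_form_update:
  assumes "u \<in> V"
  shows "dual_form (\<xi>(u := y)) = dual_form \<xi>
    + (2 * (w0 - w2) * \<xi> u + 2 * (w1 - w2) * nbr_sum \<xi> u + 2 * w2 * total \<xi>) * (y - \<xi> u)
    + w0 * (y - \<xi> u)\<^sup>2"
proof -
  have upd: "(total (\<xi>(u := y)))\<^sup>2 = (total \<xi>)\<^sup>2 + 2 * total \<xi> * (y - \<xi> u) + (y - \<xi> u)\<^sup>2"
    unfolding total_update[OF assms] by (simp add: power2_sum)
  show ?thesis
    unfolding dual_form_def upd square_sum_update[OF assms] edge_sum_update[OF assms]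
    by (simp add: algebra_simps)
qed

text \<open>The drift terms are multiples of \<open>1 - \<alpha>\<close> and, by \<open>w0_minus_w2\<close> and \<open>w1_minus_w2\<close>, of
  \<open>(1 - \<alpha>)^2\<close>, just as the variance term is. The weights are such that the coefficients of the
  square sum, the edge sum and the sum of the squared neighbour sums all cancel.\<close>

lemma step_mean_dual_form: "step_mean \<xi> dual_form = dual_form \<xi>"
proof -
  define S P K where "S = square_sum \<xi>" and "P = edge_sum \<xi> / real d" and "K = nbr_square_sum \<xi> / real d"
  have d: "real d > 0" "real d - 1 > 0" and k: "real k > 0"
    using d_ge_2 k_pos by auto
  have "w0 * (\<Sum>u\<in>V. step_var \<xi> u) = 2 * (1 - \<alpha>)\<^sup>2 *
      ((real d - real k) * S + (real k - 1) * K - 2 * real k * (real d - 1) * P + real k * (real d - 1) * S)"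
  proof -
    have cancel: "real k * (real d - 1) * ((real d * (real d - real k) * S + (real k - 1) * nbr_square_sum \<xi>)
        / (real k * (real d * (real d - 1)))) = (real d - real k) * S + (real k - 1) * K"
    proof -
      have "real k * e * (Y / (real k * (real d * e))) = Y / real d" if "e > 0" for e Y
        using d k that by (simp add: field_simps)
      note quot = this[OF d(2)]
      show ?thesis
        unfolding quot using d by (simp add: K_def add_divide_distrib)
    qed
    have expand: "w0 * (X * (a - 2 * edge_sum \<xi> / real d + S)) = 2 * X * (real k * (real d - 1) * a
        - 2 * real k * (real d - 1) * P + real k * (real d - 1) * S)" for X a
      by (simp add: w0_def P_def algebra_simps)
    show ?thesis by (simp only: sum_step_var S_def[symmetric] expand cancel)
  qed
  moreover have "edge_sum \<xi> = real d * P"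
    using d by (simp add: P_def)
  then have "2 * (1 - \<alpha>) * ((w0 - w2) * (P - S) + (w1 - w2) * (K - edge_sum \<xi>))
      + 2 * (1 - \<alpha>)\<^sup>2 * ((real d - real k) * S + (real k - 1) * K - 2 * real k * (real d - 1) * P
          + real k * (real d - 1) * S) = 0"
    unfolding w0_minus_w2 w1_minus_w2 by (simp add: power2_eq_square algebra_simps)
  moreover have "step_mean \<xi> dual_form = dual_form \<xi>
      + ((\<Sum>u\<in>V. (2 * (w0 - w2) * \<xi> u + 2 * (w1 - w2) * nbr_sum \<xi> u + 2 * w2 * total \<xi>)
              * ((1 - \<alpha>) * (nbr_sum \<xi> u / real d - \<xi> u)))
         + w0 * (\<Sum>u\<in>V. step_var \<xi> u)) / n"
    by (rule step_mean_quadratic) (rule dual_form_update)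
  ultimately show ?thesis
    unfolding sum_drift_weighted by (simp add: S_def P_def K_def)
qed

lemma avg_eq: "avg G \<xi> = total \<xi> / n"
  by (simp add: avg_def total_def)

text \<open>Both sides agree on constant vectors, where only the average contributes. All rows of the
  weight matrix have the same sum, so no mixed term of the average and the deviations from it appears.\<close>

lemma dual_form_eq_avg:
  "dual_form \<xi> = weight_sum * (avg G \<xi>)\<^sup>2 + 2 * (1 - \<alpha>) * (real d - real k) * spread \<xi>
     + (1 - \<alpha>) * (real k - 1) / 2 * dirichlet \<xi>"
proof -
  have e: "edge_sum \<xi> = real d * square_sum \<xi> - dirichlet \<xi> / 2"
    by (simp add: dirichlet_eq diff_divide_distrib)
  have s: "square_sum \<xi> = spread \<xi> + (total \<xi>)\<^sup>2 / n"
    by (simp add: spread_def)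
  have w: "weight_sum * (avg G \<xi>)\<^sup>2 = w2 * (total \<xi>)\<^sup>2 + 2 * (1 - \<alpha>) * (real d - real k) * ((total \<xi>)\<^sup>2 / n)"
    using V_nonempty pair_finite_verts by (simp add: weight_sum_def avg_eq power2_eq_square field_simps)
  show ?thesis
    unfolding w dual_form_def w0_minus_w2 w1_minus_w2 e s
    by (simp add: algebra_simps add_divide_distrib diff_divide_distrib)
qed

section \<open>Long-term behaviour\<close>

abbreviation mean :: "('a \<Rightarrow> real) \<Rightarrow> nat \<Rightarrow> (('a \<Rightarrow> real) \<Rightarrow> real) \<Rightarrow> real" where
  "mean \<xi>0 t \<equiv> measure_pmf.expectation (node_model G \<alpha> k \<xi>0 t)"

lemma finite_set_node_model: "finite (set_pmf (node_model G \<alpha> k \<xi>0 t))"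
  by (induction t) (auto simp: finite_set_node_step)

lemma integrable_node_model [simp]:
  fixes h :: "('a \<Rightarrow> real) \<Rightarrow> real"
  shows "integrable (measure_pmf (node_model G \<alpha> k \<xi>0 t)) h"
  by (rule integrable_measure_pmf_finite[OF finite_set_node_model])

lemma mean_Suc: "mean \<xi>0 (Suc t) h = mean \<xi>0 t (\<lambda>\<xi>. step_mean \<xi> h)"
proof -
  let ?M = "node_model G \<alpha> k \<xi>0 t"
  have "mean \<xi>0 (Suc t) h = (\<Sum>\<xi>\<in>set_pmf ?M. pmf ?M \<xi> *\<^sub>R step_mean \<xi> h)"
    unfolding node_model.simps by (rule pmf_expectation_bind) (auto simp: finite_set_node_model finite_set_node_step)
  also have "\<dots> = mean \<xi>0 t (\<lambda>\<xi>. step_mean \<xi> h)"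
    by (rule integral_measure_pmf[symmetric]) (auto simp: finite_set_node_model)
  finally show ?thesis .
qed

lemma mean_invariant:
  assumes "\<And>\<xi>. step_mean \<xi> h = h \<xi>"
  shows "mean \<xi>0 t h = h \<xi>0"
proof (induction t)
  case (Suc t)
  then show ?case by (simp only: mean_Suc assms)
qed simp

lemma incseq_mean_avg_square: "incseq (\<lambda>t. mean \<xi>0 t (\<lambda>\<xi>. (avg G \<xi>)\<^sup>2))"
proof (rule incseq_SucI)
  fix t
  have "(avg G \<xi>)\<^sup>2 \<le> step_mean \<xi> (\<lambda>\<xi>. (avg G \<xi>)\<^sup>2)" for \<xi>
  proof -
    have "step_mean \<xi> (\<lambda>\<xi>. (avg G \<xi>)\<^sup>2) = step_mean \<xi> (\<lambda>\<xi>. (total \<xi>)\<^sup>2) / n\<^sup>2"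
      by (simp add: avg_eq power_divide)
    moreover have "0 \<le> (\<Sum>u\<in>V. step_var \<xi> u) / n"
      using n_pos by (intro divide_nonneg_pos sum_nonneg step_var_nonneg)
    ultimately show ?thesis
      by (simp add: step_mean_total_square avg_eq power_divide divide_right_mono)
  qed
  then show "mean \<xi>0 t (\<lambda>\<xi>. (avg G \<xi>)\<^sup>2) \<le> mean \<xi>0 (Suc t) (\<lambda>\<xi>. (avg G \<xi>)\<^sup>2)"
    unfolding mean_Suc by (intro integral_mono integrable_node_model)
qed

text \<open>Summing the dissipation inequality over time bounds the sum of all mean energies by a
  multiple of the initial square sum.\<close>

lemma mean_dirichlet_tendsto_0: "(\<lambda>t. mean \<xi>0 t dirichlet) \<longlonglongrightarrow> 0"
proof -
  define c where "c = \<alpha> * (1 - \<alpha>) / (n * real d)"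
  have c: "c > 0"
    using \<alpha>_pos \<alpha>_less_1 n_pos d_ge_2 by (simp add: c_def)
  have drop: "mean \<xi>0 (Suc t) square_sum \<le> mean \<xi>0 t square_sum - c * mean \<xi>0 t dirichlet" for t
  proof -
    have "mean \<xi>0 (Suc t) square_sum \<le> mean \<xi>0 t (\<lambda>\<xi>. square_sum \<xi> - c * dirichlet \<xi>)"
      unfolding mean_Suc c_def
      by (intro integral_mono integrable_node_model step_mean_square_sum_le)
    also have "\<dots> = mean \<xi>0 t square_sum - c * mean \<xi>0 t dirichlet"
      by (subst Bochner_Integration.integral_diff) auto
    finally show ?thesis .
  qed
  have "c * (\<Sum>i<t. mean \<xi>0 i dirichlet) + mean \<xi>0 t square_sum \<le> square_sum \<xi>0" for t
  proof (induction t)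
    case (Suc t)
    then show ?case using drop[of t] by (simp only: sum.lessThan_Suc distrib_left)
  qed simp
  moreover have "0 \<le> mean \<xi>0 t square_sum" for t
    by (intro Bochner_Integration.integral_nonneg square_sum_nonneg)
  ultimately have "c * (\<Sum>i<t. mean \<xi>0 i dirichlet) \<le> square_sum \<xi>0" for t
    by (smt (verit))
  then have "(\<Sum>i<t. mean \<xi>0 i dirichlet) \<le> square_sum \<xi>0 / c" for t
    using c by (simp add: pos_le_divide_eq mult.commute)
  then have "summable (\<lambda>t. mean \<xi>0 t dirichlet)"
    by (intro summableI_nonneg_bounded Bochner_Integration.integral_nonneg dirichlet_nonneg)
  then show ?thesis by (rule summable_LIMSEQ_zero)
qed

lemma mean_spread_tendsto_0: "(\<lambda>t. mean \<xi>0 t spread) \<longlonglongrightarrow> 0"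
proof -
  obtain C where C: "\<And>\<xi>. spread \<xi> \<le> C * dirichlet \<xi>" using poincare by blast
  show ?thesis
  proof (rule tendsto_sandwich[OF always_eventually always_eventually])
    show "\<forall>t. 0 \<le> mean \<xi>0 t spread"
      by (intro allI Bochner_Integration.integral_nonneg spread_nonneg)
    show "\<forall>t. mean \<xi>0 t spread \<le> C * mean \<xi>0 t dirichlet"
    proof
      fix t
      have "mean \<xi>0 t spread \<le> mean \<xi>0 t (\<lambda>\<xi>. C * dirichlet \<xi>)"
        by (intro integral_mono integrable_node_model C)
      then show "mean \<xi>0 t spread \<le> C * mean \<xi>0 t dirichlet" by simp
    qed
    show "(\<lambda>t. C * mean \<xi>0 t dirichlet) \<longlonglongrightarrow> 0"
      using tendsto_mult_left[OF mean_dirichlet_tendsto_0, of C] by simp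
  qed simp
qed

lemma mean_avg_square_tendsto:
  assumes "weight_sum \<noteq> 0"
  shows "(\<lambda>t. mean \<xi>0 t (\<lambda>\<xi>. (avg G \<xi>)\<^sup>2)) \<longlonglongrightarrow> dual_form \<xi>0 / weight_sum"
proof -
  let ?a = "2 * (1 - \<alpha>) * (real d - real k)" and ?b = "(1 - \<alpha>) * (real k - 1) / 2"
  have "mean \<xi>0 t (\<lambda>\<xi>. (avg G \<xi>)\<^sup>2)
      = (dual_form \<xi>0 - ?a * mean \<xi>0 t spread - ?b * mean \<xi>0 t dirichlet) / weight_sum" for t
  proof -
    have "dual_form \<xi>0 = mean \<xi>0 t dual_form"
      by (rule mean_invariant[symmetric]) (rule step_mean_dual_form)
    also have "\<dots> = mean \<xi>0 t
        (\<lambda>\<xi>. weight_sum * (avg G \<xi>)\<^sup>2 + ?a * spread \<xi> + ?b * dirichlet \<xi>)"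
      by (intro arg_cong[where f = "mean \<xi>0 t"] ext dual_form_eq_avg)
    also have "\<dots> = weight_sum * mean \<xi>0 t (\<lambda>\<xi>. (avg G \<xi>)\<^sup>2)
        + ?a * mean \<xi>0 t spread + ?b * mean \<xi>0 t dirichlet"
      by (simp only: Bochner_Integration.integral_add integrable_node_model integral_mult_right_zero)
    finally show ?thesis using assms by (simp add: field_simps)
  qed
  moreover have "(\<lambda>t. (dual_form \<xi>0 - ?a * mean \<xi>0 t spread - ?b * mean \<xi>0 t dirichlet) / weight_sum)
      \<longlonglongrightarrow> (dual_form \<xi>0 - ?a * 0 - ?b * 0) / weight_sum"
    using assms by (intro tendsto_intros mean_spread_tendsto_0 mean_dirichlet_tendsto_0)
  ultimately show ?thesis by simp
qed

lemma variance_avg: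
  assumes "avg G \<xi>0 = 0"
  shows "measure_pmf.variance (node_model G \<alpha> k \<xi>0 t) (avg G) = mean \<xi>0 t (\<lambda>\<xi>. (avg G \<xi>)\<^sup>2)"
proof -
  have "avg G = (\<lambda>\<xi>. total \<xi> / n)"
    by (rule ext) (rule avg_eq)
  then have "step_mean \<xi> (avg G) = avg G \<xi>" for \<xi>
    by (simp add: step_mean_total)
  then have "mean \<xi>0 t (avg G) = avg G \<xi>0"
    by (rule mean_invariant)
  then show ?thesis using assms by simp
qed

lemma variance_avg_bounds:
  assumes "avg G \<xi>0 = 0" "weight_sum \<noteq> 0"
  shows "measure_pmf.variance (node_model G \<alpha> k \<xi>0 t) (avg G) \<le> dual_form \<xi>0 / weight_sum"
    and "(\<lambda>t. measure_pmf.variance (node_model G \<alpha> k \<xi>0 t) (avg G)) \<longlonglongrightarrow> dual_form \<xi>0 / weight_sum"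
  using assms incseq_le[OF incseq_mean_avg_square mean_avg_square_tendsto] mean_avg_square_tendsto
  by (simp_all only: variance_avg not_False_eq_True)

end

theorem proposition5p8:
  fixes G :: "'a pair_pre_digraph" and \<xi>0 :: "'a \<Rightarrow> real"
    and n d k :: nat and \<alpha> \<gamma> l \<mu>0 \<mu>1 \<mu>p :: real
  assumes "pair_graph G"
    and "Digraph_Component.connected (with_proj G)"
    and "regular_graph G d"
    and "n = card (pverts G)"
    and "0 < \<alpha>" and "\<alpha> < 1"
    and "1 \<le> k" and "k \<le> d"
    and "avg G \<xi>0 = 0"
    and "\<gamma> = real k * (1 + \<alpha>) - (1 - \<alpha>)"
    and "real n * (real n * (real d * \<gamma> - 2 * \<alpha> * real k) + 2 * (1 - \<alpha>) * (real d - real k)) \<noteq> 0"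
    and "l = 1 / (real n * (real n * (real d * \<gamma> - 2 * \<alpha> * real k)
                 + 2 * (1 - \<alpha>) * (real d - real k)))"
    and "\<mu>0 = 2 * real k * (real d - 1) * l"
    and "\<mu>1 = (real d - 1) * \<gamma> * l"
    and "\<mu>p = (real d * \<gamma> - 2 * \<alpha> * real k) * l"
  shows "(\<forall>t. measure_pmf.variance (node_model G \<alpha> k \<xi>0 t) (avg G)
              \<le> (\<mu>0 - \<mu>p) * (\<Sum>u\<in>pverts G. (\<xi>0 u)\<^sup>2)
                + (\<mu>1 - \<mu>p) * (\<Sum>(u, v)\<in>parcs G. \<xi>0 u * \<xi>0 v) + 1 / real n ^ 5)
       \<and> (\<exists>T. \<forall>t\<ge>T. measure_pmf.variance (node_model G \<alpha> k \<xi>0 t) (avg G)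
              \<ge> (\<mu>0 - \<mu>p) * (\<Sum>u\<in>pverts G. (\<xi>0 u)\<^sup>2)
                + (\<mu>1 - \<mu>p) * (\<Sum>(u, v)\<in>parcs G. \<xi>0 u * \<xi>0 v) - 1 / real n ^ 5)"
proof -
  \<comment> \<open>For \<open>d = 1\<close> the three unnormalised weights vanish, and the normalisation with them.\<close>
  have "2 \<le> d"
  proof (rule ccontr)
    assume "\<not> 2 \<le> d"
    then have "d = 1" "k = 1" using \<open>1 \<le> k\<close> \<open>k \<le> d\<close> by auto
    then show False using assms(10,11) by simp
  qed
  then interpret M: regular_node_model G d k \<alpha>
    using assms(1-8) by (intro regular_node_model.intro regular_node_model_axioms.intro)
  let ?var = "\<lambda>t. measure_pmf.variance (node_model G \<alpha> k \<xi>0 t) (avg G)"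
  define B where "B = (\<mu>0 - \<mu>p) * (\<Sum>u\<in>pverts G. (\<xi>0 u)\<^sup>2)
      + (\<mu>1 - \<mu>p) * (\<Sum>(u, v)\<in>parcs G. \<xi>0 u * \<xi>0 v)"
  have \<gamma>: "M.\<gamma> = \<gamma>" using assms(10) by (simp add: M.\<gamma>_def)
  have w: "M.weight_sum = real n * (real n * (real d * \<gamma> - 2 * \<alpha> * real k)
      + 2 * (1 - \<alpha>) * (real d - real k))"
    by (simp only: M.weight_sum_def M.w2_def \<gamma> assms(4))
  have l: "l = 1 / M.weight_sum"
    using assms(12) by (simp only: w)
  have nz: "M.weight_sum \<noteq> 0"
    using assms(11) by (simp only: w) simp
  have \<mu>: "\<mu>0 = M.w0 * l" "\<mu>1 = M.w1 * l" "\<mu>p = M.w2 * l"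
    using assms(13-15) by (simp_all only: M.w0_def M.w1_def M.w2_def \<gamma>)
  have "M.total \<xi>0 = 0"
    using assms(9) M.V_nonempty M.pair_finite_verts by (simp add: M.avg_eq)
  then have "M.dual_form \<xi>0 / M.weight_sum = B"
    by (simp add: B_def M.dual_form_def \<mu> l M.square_sum_def M.edge_sum_eq_arcs
        add_divide_distrib diff_divide_distrib left_diff_distrib)
  then have upper: "?var t \<le> B" and lim: "?var \<longlonglongrightarrow> B" for t
    using M.variance_avg_bounds[OF assms(9) nz] by simp_all
  have pos: "1 / real n ^ 5 > 0"
    using M.n_pos assms(4) by simp
  have "\<forall>t. ?var t \<le> B + 1 / real n ^ 5"
    using upper pos by (smt (verit))
  moreover have "\<exists>T. \<forall>t\<ge>T. ?var t \<ge> B - 1 / real n ^ 5"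
  proof -
    have "eventually (\<lambda>t. ?var t > B - 1 / real n ^ 5) sequentially"
      using pos by (intro order_tendstoD(1)[OF lim]) simp
    then show ?thesis by (auto simp: eventually_sequentially intro: less_imp_le)
  qed
  ultimately show ?thesis unfolding B_def by blast
qed

end
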